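(* Let $n\ge 1$ and $m_1,\dots,m_n\ge1$ be integers. For almost every (with respect to Lebesgue measure) $n$-player game $G$ of size $m_1\times\cdots\times m_n$: (i) $G$ has a finite number of Nash equilibria, and (ii) there is a neighborhood of $G$ in the set of games of this size such that every game in this neighborhood has the same number of Nash equilibria as $G$.
   Context: A finite $n$-player game of size $m_1\times\cdots\times m_n$ has pure strategy sets $S^i$ with $|S^i|=m_i$ ($i=1,\dots,n$) and utility functions $U^i:\times_j S^j\to\mathbb{R}$. Fixing the strategy sets, the game is identified with its payoffs, a point of $(\mathbb{R}^{m_1m_2\cdots m_n})^n$, with its usual topology and Lebesgue measure. Nash equilibria are taken in mixed strategies. *)

theory Defs
  imports "HOL-Analysis.Analysis"
begin

text \<open>
  Players are the elements of a finite type \<open>'p\<close>, so the number of players is \<open>CARD('p)\<close>, which is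
  at least 1.  The strategy sets \<open>S i\<close> are subsets of a common finite type \<open>'a\<close>; they may have
  different sizes.  A game \<open>G\<close> is a real function on pairs of a player and a pure profile:
  \<open>G (i, s)\<close> is the payoff of player \<open>i\<close> at \<open>s\<close>.
\<close>

definition pure_profiles :: "('p::finite \<Rightarrow> 'a::finite set) \<Rightarrow> ('p \<Rightarrow> 'a) set" where
  "pure_profiles S = (\<Pi>\<^sub>E i\<in>UNIV. S i)"

text \<open>
  The points of both spaces below are the functions on \<open>UNIV \<times> pure_profiles S\<close>, extended by
  \<open>undefined\<close>.  As for the library's \<open>lebesgue\<close>, the measure is the completion of the Borel one.
\<close>

definition game_topology ::
    "('p::finite \<Rightarrow> 'a::finite set) \<Rightarrow> ('p \<times> ('p \<Rightarrow> 'a) \<Rightarrow> real) topology" where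
  "game_topology S = product_topology (\<lambda>_. euclideanreal) (UNIV \<times> pure_profiles S)"

definition game_lebesgue ::
    "('p::finite \<Rightarrow> 'a::finite set) \<Rightarrow> ('p \<times> ('p \<Rightarrow> 'a) \<Rightarrow> real) measure" where
  "game_lebesgue S = completion (Pi\<^sub>M (UNIV \<times> pure_profiles S) (\<lambda>_. lborel))"

text \<open>
  Mixed strategies are extensional, so that distinct functions are distinct mixed strategies and
  cardinalities of sets of equilibria are meaningful.
\<close>

definition mixed_strategies :: "'a::finite set \<Rightarrow> ('a \<Rightarrow> real) set" where
  "mixed_strategies A = {p \<in> extensional A. (\<forall>a\<in>A. 0 \<le> p a) \<and> (\<Sum>a\<in>A. p a) = 1}"

definition mixed_profiles :: "('p::finite \<Rightarrow> 'a::finite set) \<Rightarrow> ('p \<Rightarrow> 'a \<Rightarrow> real) set" where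
  "mixed_profiles S = (\<Pi>\<^sub>E i\<in>UNIV. mixed_strategies (S i))"

definition expected_utility ::
    "('p::finite \<Rightarrow> 'a::finite set) \<Rightarrow> ('p \<times> ('p \<Rightarrow> 'a) \<Rightarrow> real) \<Rightarrow> 'p \<Rightarrow> ('p \<Rightarrow> 'a \<Rightarrow> real) \<Rightarrow> real"
  where
  "expected_utility S G i \<sigma> = (\<Sum>s\<in>pure_profiles S. (\<Prod>j\<in>UNIV. \<sigma> j (s j)) * G (i, s))"

definition nash_equilibria ::
    "('p::finite \<Rightarrow> 'a::finite set) \<Rightarrow> ('p \<times> ('p \<Rightarrow> 'a) \<Rightarrow> real) \<Rightarrow> ('p \<Rightarrow> 'a \<Rightarrow> real) set" where
  "nash_equilibria S G =
     {\<sigma> \<in> mixed_profiles S. \<forall>i. \<forall>\<tau>\<in>mixed_strategies (S i).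
        expected_utility S G i (\<sigma>(i := \<tau>)) \<le> expected_utility S G i \<sigma>}"

end

theory Submission
  imports Defs
begin

text \<open>
  The equilibrium graph is parametrised as by Kohlberg and Mertens.  Fix a pure profile \<open>b\<close>.  An
  equilibrium \<open>\<sigma>\<close> of \<open>G\<close> is encoded by the game \<open>H\<close> obtained from \<open>G\<close> by adding to the payoffs of
  player \<open>i\<close> a function of the strategy of \<open>i\<close> alone, so that \<open>H (i, b(i := a))\<close> becomes \<open>\<sigma> i a\<close> plus
  the payoff of \<open>a\<close> against \<open>\<sigma>\<close>.  For a given support \<open>T\<close>, the strategies and then \<open>G\<close> are
  polynomial in \<open>H\<close>, so the equilibria of \<open>G\<close> correspond to the preimages of \<open>G\<close> under a proper map
  that is polynomial on finitely many closed regions.  The boundaries of the regions lie in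
  hyperplanes, and the critical values are null by Sard's theorem; all preimages of any other \<open>G\<close> are
  regular interior points, so by the inverse function theorem and properness there are finitely many
  of them, and as many for every nearby game.
\<close>

subsection \<open>Critical values\<close>

text \<open>
  \<open>baby_Sard\<close> is stated for \<open>real ^ 'n\<close> with a well-ordered index type; this index type serves to
  transfer it to an arbitrary Euclidean space.
\<close>

typedef (overloaded) ('a::euclidean_space) coordinate = "{..<DIM('a)}"
  by (auto intro!: exI[of _ 0])

instantiation coordinate :: (euclidean_space) linorder
begin

definition less_eq_coordinate :: "'a coordinate \<Rightarrow> 'a coordinate \<Rightarrow> bool" where
  "x \<le> y \<longleftrightarrow> Rep_coordinate x \<le> Rep_coordinate y"

definition less_coordinate :: "'a coordinate \<Rightarrow> 'a coordinate \<Rightarrow> bool" where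
  "x < y \<longleftrightarrow> Rep_coordinate x < Rep_coordinate y"

instance
  by standard (auto simp: less_eq_coordinate_def less_coordinate_def Rep_coordinate_inject)

end

instance coordinate :: (euclidean_space) finite
proof
  have "UNIV = (Abs_coordinate :: nat \<Rightarrow> 'a coordinate) ` {..<DIM('a)}"
    using type_definition.Abs_image[OF type_definition_coordinate] by auto
  then show "finite (UNIV :: 'a coordinate set)"
    by (metis finite_imageI finite_lessThan)
qed

instance coordinate :: (euclidean_space) wellorder
proof
  fix P :: "'a coordinate \<Rightarrow> bool" and a
  assume step: "\<And>x. (\<And>y. y < x \<Longrightarrow> P y) \<Longrightarrow> P x"
  show "P a"
    by (induction a rule: measure_induct_rule[of Rep_coordinate])
      (rule step, simp only: less_coordinate_def)
qed

lemma card_coordinate: "CARD('a::euclidean_space coordinate) = DIM('a)"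
  using type_definition.card[OF type_definition_coordinate] by auto

text \<open>Conjugation by a linear isomorphism with \<open>real ^ 'a coordinate\<close> reduces the
  claim to \<open>baby_Sard\<close>: a non-injective endomorphism has rank below the
  dimension.\<close>

lemma Sard_equal_dimension:
  fixes f :: "'a::euclidean_space \<Rightarrow> 'a"
  assumes der: "\<And>x. x \<in> S \<Longrightarrow> (f has_derivative f' x) (at x within S)"
    and crit: "\<And>x. x \<in> S \<Longrightarrow> \<not> inj (f' x)"
  shows "negligible (f ` S)"
proof -
  have "DIM('a) = DIM(real ^ 'a coordinate)"
    by (simp add: card_coordinate)
  then obtain p :: "'a \<Rightarrow> real ^ 'a coordinate" and q
    where pq: "linear p" "linear q" "\<And>x. q (p x) = x" "\<And>y. p (q y) = y"
    using isomorphisms_UNIV_UNIV by metis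
  have blp: "bounded_linear p" and blq: "bounded_linear q"
    using pq linear_conv_bounded_linear by auto
  define F where "F = (\<lambda>y. p (f (q y)))"
  define F' where "F' = (\<lambda>y. p \<circ> f' (q y) \<circ> q)"
  have F: "(F has_derivative F' y) (at y within p ` S)" if "y \<in> p ` S" for y
  proof -
    have "q y \<in> S"
      using that pq by auto
    have qd: "(q has_derivative q) (at y within p ` S)"
      using blq by (rule bounded_linear_imp_has_derivative)
    have "(f has_derivative f' (q y)) (at (q y) within q ` p ` S)"
      using der[OF \<open>q y \<in> S\<close>] pq by (simp add: image_image)
    from diff_chain_within[OF qd this]
    have "(f \<circ> q has_derivative f' (q y) \<circ> q) (at y within p ` S)" .
    from bounded_linear.has_derivative[OF blp this] show ?thesis
      by (simp add: F_def F'_def o_def)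
  qed
  have "negligible (F ` (p ` S))"
  proof (rule baby_Sard)
    show "(F has_derivative F' y) (at y within p ` S)" if "y \<in> p ` S" for y
      using F that .
    show "rank (matrix (F' y)) < CARD('a coordinate)" if "y \<in> p ` S" for y
    proof -
      have "q y \<in> S"
        using that pq by auto
      have lin: "linear (F' y)"
        using F[OF that] has_derivative_linear by blast
      have "\<not> inj (F' y)"
      proof
        assume inj: "inj (F' y)"
        have "f' (q y) = q \<circ> F' y \<circ> p"
          using pq by (auto simp: F'_def fun_eq_iff)
        moreover have "inj (q \<circ> F' y \<circ> p)"
          by (metis inj inj_compose injI pq(3,4))
        ultimately show False
          using crit[OF \<open>q y \<in> S\<close>] by simp
      qed
      moreover have "(*v) (matrix (F' y)) = F' y"
        using matrix_works lin by (auto simp: linear_matrix_vector_mul_eq)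
      ultimately show ?thesis
        by (simp add: less_rank_noninjective)
    qed
  qed simp
  \<comment> \<open>Being linear between spaces of equal dimension, \<open>q\<close> carries null
    sets to null sets.\<close>
  then have "negligible (q ` (F ` (p ` S)))"
    by (rule negligible_differentiable_image_negligible[rotated])
      (simp_all add: card_coordinate blq bounded_linear_imp_differentiable_on)
  then show ?thesis
    by (simp add: image_image F_def pq)
qed


subsection \<open>Continuously differentiable maps\<close>

text \<open>The derivative is a map into the bounded linear maps with the operator norm, the form of
  continuity that the inverse function theorem asks for.\<close>

definition continuously_differentiable ::
    "('a::real_normed_vector \<Rightarrow> 'b::real_normed_vector) \<Rightarrow> bool" where
  "continuously_differentiable f \<longleftrightarrow>
     (\<exists>f' :: 'a \<Rightarrow> 'a \<Rightarrow>\<^sub>L 'b.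
        (\<forall>x. (f has_derivative blinfun_apply (f' x)) (at x)) \<and> continuous_on UNIV f')"

lemma continuously_differentiableI:
  assumes "\<And>x. (f has_derivative blinfun_apply (f' x)) (at x)" "continuous_on UNIV f'"
  shows "continuously_differentiable f"
  using assms by (auto simp: continuously_differentiable_def)

lemma continuously_differentiable_imp_continuous_on:
  "continuously_differentiable f \<Longrightarrow> continuous_on A f"
  by (meson continuously_differentiable_def continuous_at_imp_continuous_on has_derivative_continuous)

lemma continuously_differentiable_imp_differentiable_on:
  "continuously_differentiable f \<Longrightarrow> f differentiable_on A"
  by (meson continuously_differentiable_def differentiable_at_imp_differentiable_on differentiableI)

lemma continuously_differentiable_const: "continuously_differentiable (\<lambda>x. c)"
  by (rule continuously_differentiableI[where f' = "\<lambda>_. 0"]) (auto simp: zero_blinfun.rep_eq)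

lemma continuously_differentiable_linear:
  assumes "bounded_linear f"
  shows "continuously_differentiable f"
  by (rule continuously_differentiableI[where f' = "\<lambda>_. Blinfun f"])
    (auto simp: bounded_linear_Blinfun_apply assms bounded_linear_imp_has_derivative)

lemma continuously_differentiable_compose_linear:
  assumes "bounded_linear l" "continuously_differentiable f"
  shows "continuously_differentiable (\<lambda>x. l (f x))"
proof -
  obtain f' where f': "\<And>x. (f has_derivative blinfun_apply (f' x)) (at x)" "continuous_on UNIV f'"
    using assms(2) unfolding continuously_differentiable_def by auto
  show ?thesis
  proof (rule continuously_differentiableI[where f' = "\<lambda>x. Blinfun l o\<^sub>L f' x"])
    show "((\<lambda>x. l (f x)) has_derivative blinfun_apply (Blinfun l o\<^sub>L f' x)) (at x)" for x
    proof -
      have "blinfun_apply (Blinfun l o\<^sub>L f' x) = (\<lambda>y. l (blinfun_apply (f' x) y))"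
        by (auto simp: bounded_linear_Blinfun_apply assms(1))
      then show ?thesis
        using bounded_linear.has_derivative[OF assms(1) f'(1)[of x]] by simp
    qed
  qed (intro continuous_intros f')
qed

lemma continuously_differentiable_add:
  assumes "continuously_differentiable f" "continuously_differentiable g"
  shows "continuously_differentiable (\<lambda>x. f x + g x)"
proof -
  obtain f' where f': "\<And>x. (f has_derivative blinfun_apply (f' x)) (at x)" "continuous_on UNIV f'"
    using assms(1) unfolding continuously_differentiable_def by auto
  obtain g' where g': "\<And>x. (g has_derivative blinfun_apply (g' x)) (at x)" "continuous_on UNIV g'"
    using assms(2) unfolding continuously_differentiable_def by auto
  show ?thesis
  proof (rule continuously_differentiableI[where f' = "\<lambda>x. f' x + g' x"])
    show "((\<lambda>x. f x + g x) has_derivative blinfun_apply (f' x + g' x)) (at x)" for x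
      using has_derivative_add[OF f'(1) g'(1)] by (simp add: plus_blinfun.rep_eq)
  qed (intro continuous_intros f' g')
qed

lemma continuously_differentiable_mult:
  fixes f g :: "'a::real_normed_vector \<Rightarrow> real"
  assumes f: "continuously_differentiable f" and g: "continuously_differentiable g"
  shows "continuously_differentiable (\<lambda>x. f x * g x)"
proof -
  obtain f' where f': "\<And>x. (f has_derivative blinfun_apply (f' x)) (at x)" "continuous_on UNIV f'"
    using f unfolding continuously_differentiable_def by auto
  obtain g' where g': "\<And>x. (g has_derivative blinfun_apply (g' x)) (at x)" "continuous_on UNIV g'"
    using g unfolding continuously_differentiable_def by auto
  show ?thesis
  proof (rule continuously_differentiableI[where f' = "\<lambda>x. f x *\<^sub>R g' x + g x *\<^sub>R f' x"])
    show "((\<lambda>x. f x * g x) has_derivative blinfun_apply (f x *\<^sub>R g' x + g x *\<^sub>R f' x)) (at x)" for x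
      using has_derivative_mult[OF f'(1) g'(1)]
      by (simp add: plus_blinfun.rep_eq scaleR_blinfun.rep_eq mult.commute)
  qed (intro continuous_intros f' g' continuously_differentiable_imp_continuous_on f g)
qed

lemma continuously_differentiable_diff:
  assumes "continuously_differentiable f" "continuously_differentiable g"
  shows "continuously_differentiable (\<lambda>x. f x - g x)"
  using continuously_differentiable_add[OF assms(1)
      continuously_differentiable_compose_linear[OF bounded_linear_minus[OF bounded_linear_ident] assms(2)]]
  by simp

lemma continuously_differentiable_sum:
  "(\<And>i. i \<in> I \<Longrightarrow> continuously_differentiable (f i)) \<Longrightarrow>
    continuously_differentiable (\<lambda>x. \<Sum>i\<in>I. f i x)"
  by (induction I rule: infinite_finite_induct)
    (auto intro: continuously_differentiable_const continuously_differentiable_add)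

lemma continuously_differentiable_prod:
  fixes f :: "'i \<Rightarrow> 'a::real_normed_vector \<Rightarrow> real"
  shows "(\<And>i. i \<in> I \<Longrightarrow> continuously_differentiable (f i)) \<Longrightarrow>
    continuously_differentiable (\<lambda>x. \<Prod>i\<in>I. f i x)"
  by (induction I rule: infinite_finite_induct)
    (auto intro: continuously_differentiable_const continuously_differentiable_mult)

lemma continuously_differentiable_vec_nth: "continuously_differentiable (\<lambda>x::real^'n. x $ i)"
  by (intro continuously_differentiable_linear bounded_linear_vec_nth)

text \<open>Decomposing the vector along the axes reduces the claim to sums and linear images of the
  components.\<close>

lemma continuously_differentiable_vec_lambda:
  fixes f :: "'n::finite \<Rightarrow> 'a::real_normed_vector \<Rightarrow> real"
  assumes "\<And>i. continuously_differentiable (f i)"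
  shows "continuously_differentiable (\<lambda>x. \<chi> i. f i x)"
proof -
  have "continuously_differentiable (\<lambda>x. \<Sum>i\<in>UNIV. f i x *\<^sub>R axis i (1::real))"
    by (intro continuously_differentiable_sum
        continuously_differentiable_compose_linear[OF bounded_linear_scaleR_left] assms)
  moreover have "(\<Sum>i\<in>UNIV. f i x *\<^sub>R axis i (1::real)) = (\<chi> i. f i x)" for x
    by (simp add: vec_eq_iff axis_def if_distrib[of "\<lambda>y. _ * y"] cong: if_cong)
  ultimately show ?thesis
    by simp
qed

lemmas continuously_differentiable_intros =
  continuously_differentiable_const continuously_differentiable_add continuously_differentiable_mult
  continuously_differentiable_diff continuously_differentiable_sum continuously_differentiable_prod
  continuously_differentiable_vec_nth continuously_differentiable_vec_lambda

text \<open>The critical points serve as \<open>C\<close>: their image is null by Sard's theorem,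
  and at every other point the inverse function theorem applies. The set \<open>D\<close> later
  confines the neighbourhood to a single region.\<close>

lemma local_homeomorphism_or_critical:
  fixes f :: "'a::euclidean_space \<Rightarrow> 'a"
  assumes "continuously_differentiable f"
  obtains C where "negligible (f ` C)"
    and "\<And>x D. x \<notin> C \<Longrightarrow> open D \<Longrightarrow> x \<in> D \<Longrightarrow>
      \<exists>U V g. open U \<and> x \<in> U \<and> U \<subseteq> D \<and> open V \<and> f x \<in> V \<and> homeomorphism U V f g"
proof -
  obtain f' where f': "\<And>x. (f has_derivative blinfun_apply (f' x)) (at x)" "continuous_on UNIV f'"
    using assms unfolding continuously_differentiable_def by auto
  define C where "C = {x. \<not> inj (blinfun_apply (f' x))}"
  show thesis
  proof (rule that[of C])
    show "negligible (f ` C)"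
      by (rule Sard_equal_dimension[of C f "\<lambda>x. blinfun_apply (f' x)"])
        (auto simp: C_def intro: has_derivative_at_withinI f')
    fix x D assume "x \<notin> C" and D: "open D" "x \<in> D"
    then have "inj (blinfun_apply (f' x))"
      by (simp add: C_def)
    then obtain h where h: "linear h" "h \<circ> blinfun_apply (f' x) = id"
      using linear_injective_left_inverse blinfun.bounded_linear_right
        bounded_linear.linear by blast
    have "Blinfun h o\<^sub>L f' x = id_blinfun"
      using h by (intro blinfun_eqI)
        (simp add: bounded_linear_Blinfun_apply linear_conv_bounded_linear[symmetric] fun_eq_iff)
    from inverse_function_theorem[OF D(1) f'(1) continuous_on_subset[OF f'(2)] D(2) this]
    show "\<exists>U V g. open U \<and> x \<in> U \<and> U \<subseteq> D \<and> open V \<and> f x \<in> V \<and> homeomorphism U V f g"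
      by (metis subset_UNIV)
  qed
qed


subsection \<open>Counting solutions\<close>

text \<open>\<open>P y\<close> stands for the preimages of \<open>y\<close> under a piecewise map;
  the closed graph and the bound over \<open>N\<close> replace properness. Near each solution for
  \<open>y0\<close> there is exactly one for each nearby \<open>y\<close>. Solutions elsewhere would
  lie in a compact set, which contains none once \<open>y\<close> is close to
  \<open>y0\<close>.\<close>

lemma card_solutions_locally_constant:
  fixes P :: "'b::euclidean_space \<Rightarrow> 'a::euclidean_space set"
  assumes closed: "closed {(x, y). x \<in> P y}"
    and N: "open N" "y0 \<in> N" and bdd: "bounded (\<Union>y\<in>N. P y)"
    and homeo: "\<And>x. x \<in> P y0 \<Longrightarrow> \<exists>U V f g. open U \<and> x \<in> U \<and> open V \<and> y0 \<in> V \<and>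
      homeomorphism U V f g \<and> (\<forall>x'\<in>U. \<forall>y. x' \<in> P y \<longleftrightarrow> f x' = y)"
  shows "finite (P y0) \<and>
    (\<exists>W. open W \<and> y0 \<in> W \<and> (\<forall>y\<in>W. finite (P y) \<and> card (P y) = card (P y0)))"
proof -
  define Q where "Q = (\<lambda>x U V f g. open U \<and> x \<in> U \<and> open V \<and> y0 \<in> V \<and>
      homeomorphism U V f g \<and> (\<forall>x'\<in>U. \<forall>y. x' \<in> P y \<longleftrightarrow> f x' = y))"
  have "\<forall>x\<in>P y0. \<exists>U V f g. Q x U V f g"
    using homeo by (simp add: Q_def)
  then obtain U V f g where Q: "\<And>x. x \<in> P y0 \<Longrightarrow> Q x (U x) (V x) (f x) (g x)"
    by metis
  have U: "open (U x)" "x \<in> U x" and V: "open (V x)" "y0 \<in> V x"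
    and h: "homeomorphism (U x) (V x) (f x) (g x)" if "x \<in> P y0" for x
    using Q[OF that] by (simp_all add: Q_def)
  have P: "x' \<in> P y \<longleftrightarrow> f x x' = y" if "x \<in> P y0" "x' \<in> U x" for x x' y
    using Q[OF that(1)] that(2) by (simp add: Q_def)
  have UP: "x' = x" if "x \<in> P y0" "x' \<in> U x" "x' \<in> P y0" for x x'
  proof -
    have "f x x' = y0" "f x x = y0"
      using P[OF that(1)] U(2)[OF that(1)] that by auto
    then show ?thesis
      using homeomorphism_apply1[OF h[OF that(1)] that(2)]
        homeomorphism_apply1[OF h[OF that(1)] U(2)[OF that(1)]] by simp
  qed
  have "closed ((\<lambda>x. (x, y0)) -` {(x, y). x \<in> P y})"
    by (rule closed_vimage[OF closed]) (auto intro!: continuous_intros)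
  then have "closed (P y0)"
    by (simp add: vimage_def)
  moreover have "bounded (P y0)"
    using bdd N by (auto intro: bounded_subset)
  ultimately have "compact (P y0)"
    by (simp add: compact_eq_bounded_closed)
  moreover have "P y0 \<subseteq> (\<Union>x\<in>P y0. U x)"
    using U by auto
  ultimately obtain F where F: "F \<subseteq> P y0" "finite F" "P y0 \<subseteq> (\<Union>x\<in>F. U x)"
    using compactE_image[of "P y0" "P y0" U] U by metis
  have "P y0 \<subseteq> F"
    using F UP by blast
  then have fin: "finite (P y0)"
    using F finite_subset by auto
  obtain e where e: "e > 0" "\<And>x x'. x \<in> P y0 \<Longrightarrow> x' \<in> P y0 \<Longrightarrow> dist x x' < e \<Longrightarrow> x = x'"
    using fin uniform_discrete_finite_iff[of "P y0"] by (metis uniform_discrete_def)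
  \<comment> \<open>The radius is half of a separation bound for the solutions, so these
    neighbourhoods are disjoint.\<close>
  define B where "B = (\<lambda>x. U x \<inter> ball x (e / 2))"
  have B: "open (B x)" "x \<in> B x" if "x \<in> P y0" for x
    using U that e by (auto simp: B_def)
  have disj: "x = x'" if "x \<in> P y0" "x' \<in> P y0" "z \<in> B x" "z \<in> B x'" for x x' z
    using e(2)[OF that(1,2)] that(3,4) dist_triangle_half_l[of x z e x']
    by (auto simp: B_def)
  \<comment> \<open>Since \<open>g x\<close> is continuous, demanding that the local solution lie in
    the smaller set \<open>B x\<close> still leaves an open set of \<open>y\<close>.\<close>
  define W1 where "W1 = (\<lambda>x. V x \<inter> g x -` B x)"
  have W1: "open (W1 x)" "y0 \<in> W1 x" if "x \<in> P y0" for x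
  proof -
    show "open (W1 x)"
      unfolding W1_def using h[OF that] V[OF that] B[OF that]
      by (intro continuous_open_preimage) (auto simp: homeomorphism_def)
    have "f x x = y0"
      using P[OF that] U[OF that] that by auto
    then have "g x y0 = x"
      using h[OF that] U[OF that] homeomorphism_apply1 by metis
    then show "y0 \<in> W1 x"
      using V[OF that] B[OF that] by (auto simp: W1_def)
  qed
  have ex1: "g x y \<in> B x \<inter> P y" "z \<in> B x \<inter> P y \<Longrightarrow> z = g x y" if "x \<in> P y0" "y \<in> W1 x" for x y z
  proof -
    have "g x y \<in> U x" "f x (g x y) = y" "g x y \<in> B x"
      using that h[OF that(1)] by (auto simp: W1_def B_def homeomorphism_def)
    then show "g x y \<in> B x \<inter> P y"
      using P[OF that(1)] by auto
    assume "z \<in> B x \<inter> P y"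
    then have "z \<in> U x" "f x z = y"
      using P[OF that(1), of z y] by (auto simp: B_def)
    then show "z = g x y"
      using h[OF that(1)] homeomorphism_apply1 by metis
  qed
  \<comment> \<open>This compact set catches every solution over \<open>N\<close> that escapes the
    chosen neighbourhoods. The \<open>y\<close> with a solution in it form a closed set that misses
    \<open>y0\<close>.\<close>
  define K where "K = closure (\<Union>y\<in>N. P y) - (\<Union>x\<in>P y0. B x)"
  have "compact K"
    unfolding K_def using bdd B by (intro compact_diff) (auto simp: compact_closure)
  have "closed {y. \<exists>x. x \<in> K \<and> (x, y) \<in> {(x, y). x \<in> P y}}"
    by (rule closed_compact_projection[OF \<open>compact K\<close> closed])
  then have W0: "open (- {y. \<exists>x. x \<in> K \<and> x \<in> P y})"
    by (intro open_Compl) simp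
  define W where "W = N \<inter> - {y. \<exists>x. x \<in> K \<and> x \<in> P y} \<inter> (\<Inter>x\<in>P y0. W1 x)"
  have "open W"
    unfolding W_def using fin W1 N W0 by (intro open_Int open_INT) auto
  moreover have "y0 \<in> W"
    using N W1 B(2) unfolding W_def K_def by blast
  \<comment> \<open>Each solution \<open>x\<close> for \<open>y0\<close> is continued to the unique
    solution for \<open>y\<close> in \<open>B x\<close>.\<close>
  moreover have "bij_betw (\<lambda>x. g x y) (P y0) (P y)" if "y \<in> W" for y
  proof (rule bij_betwI')
    have W: "y \<in> W1 x" if "x \<in> P y0" for x
      using \<open>y \<in> W\<close> that by (auto simp: W_def)
    show "(g x y = g x' y) = (x = x')" if "x \<in> P y0" "x' \<in> P y0" for x x'
      using ex1(1)[OF that(1) W[OF that(1)]] ex1(1)[OF that(2) W[OF that(2)]] disj that by auto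
    show "g x y \<in> P y" if "x \<in> P y0" for x
      using ex1(1)[OF that W[OF that]] by auto
    show "\<exists>x\<in>P y0. z = g x y" if "z \<in> P y" for z
    proof -
      have "z \<in> closure (\<Union>y\<in>N. P y)"
        using that \<open>y \<in> W\<close> closure_subset[of "\<Union>y\<in>N. P y"] by (auto simp: W_def)
      moreover have "z \<notin> K"
        using that \<open>y \<in> W\<close> by (auto simp: W_def)
      ultimately obtain x where "x \<in> P y0" "z \<in> B x"
        unfolding K_def by blast
      then show ?thesis
        using ex1(2)[OF _ W] that by blast
    qed
  qed
  ultimately show ?thesis
    using fin by (metis bij_betw_finite bij_betw_same_card)
qed

subsection \<open>Negligible sets and product measures\<close>

lemma borel_measurable_vec_lambda:
  "vec_lambda \<in> borel_measurable (Pi\<^sub>M UNIV (\<lambda>_::'n::finite. lborel :: real measure))"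
proof (subst borel_measurable_euclidean_space, rule ballI)
  fix b :: "real ^ 'n" assume "b \<in> Basis"
  then obtain i where "b = axis i 1"
    by (auto simp: Basis_vec_def)
  then show "(\<lambda>x. vec_lambda x \<bullet> b) \<in> borel_measurable (Pi\<^sub>M UNIV (\<lambda>_. lborel))"
    by (simp add: inner_axis)
qed

text \<open>Lebesgue measure is determined by the volumes of boxes, which correspond to products of
  intervals.\<close>

lemma lborel_vec_eq_distr_PiM:
  "(lborel :: (real ^ 'n) measure) = distr (Pi\<^sub>M UNIV (\<lambda>_. lborel)) borel vec_lambda"
proof (rule lborel_eqI)
  interpret product_sigma_finite "\<lambda>_::'n. lborel :: real measure" ..
  have meas: "vec_lambda \<in> measurable (Pi\<^sub>M UNIV (\<lambda>_. lborel)) (borel :: (real ^ 'n) measure)"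
    by (rule borel_measurable_vec_lambda)
  fix l u :: "real ^ 'n" assume le: "\<And>i. i \<in> Basis \<Longrightarrow> l \<bullet> i \<le> u \<bullet> i"
  have lu: "l $ i \<le> u $ i" for i
    using le[of "axis i 1"] by (auto simp: Basis_vec_def inner_axis)
  have "emeasure (distr (Pi\<^sub>M UNIV (\<lambda>_. lborel)) borel vec_lambda) (box l u) =
    emeasure (Pi\<^sub>M UNIV (\<lambda>_. lborel)) (\<Pi>\<^sub>E i\<in>UNIV. {l $ i<..<u $ i})"
    by (subst emeasure_distr[OF meas])
      (auto simp: space_PiM mem_box_cart PiE_def Pi_iff intro!: arg_cong2[where f = emeasure])
  also have "\<dots> = (\<Prod>i\<in>UNIV. emeasure lborel {l $ i<..<u $ i})"
    by (subst emeasure_PiM) auto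
  also have "\<dots> = (\<Prod>i\<in>UNIV. ennreal (u $ i - l $ i))"
    using lu by (intro prod.cong) auto
  also have "\<dots> = ennreal (\<Prod>i\<in>UNIV. u $ i - l $ i)"
    using lu by (intro prod_ennreal) auto
  also have "(\<Prod>i\<in>UNIV. u $ i - l $ i) = (\<Prod>b\<in>Basis. (u - l) \<bullet> b)"
  proof -
    have "(Basis :: (real ^ 'n) set) = range (\<lambda>i. axis i 1)"
      by (auto simp: Basis_vec_def)
    then have "(\<Prod>b\<in>Basis. (u - l) \<bullet> b) = (\<Prod>b\<in>range (\<lambda>i. axis i 1). (u - l) \<bullet> b)"
      by (rule arg_cong)
    also have "\<dots> = (\<Prod>i\<in>UNIV. (u - l) \<bullet> axis i 1)"
      by (subst prod.reindex) (auto simp: inj_on_def axis_eq_axis)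
    finally show ?thesis
      by (simp add: inner_axis)
  qed
  finally show "emeasure (distr (Pi\<^sub>M UNIV (\<lambda>_. lborel)) borel vec_lambda) (box l u) =
    ennreal (\<Prod>b\<in>Basis. (u - l) \<bullet> b)" .
qed simp

text \<open>Vectors have an entry for each element of the index type, games only for those in
  \<open>I\<close>; the values of \<open>y\<close> are fillers. By Fubini's theorem, for almost
  every \<open>x\<close> almost all fillers avoid \<open>N\<close>, hence at least one does.\<close>

lemma AE_PiM_extend_notin_negligible:
  fixes I :: "'n::finite set" and N :: "(real ^ 'n) set"
  assumes "negligible N"
  shows "AE x in Pi\<^sub>M I (\<lambda>_. lborel). \<exists>y. (\<chi> k. if k \<in> I then x k else y k) \<notin> N"
proof -
  interpret product_sigma_finite "\<lambda>_::'n. lborel :: real measure" ..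
  interpret I: finite_product_sigma_finite "\<lambda>_::'n. lborel :: real measure" I by standard simp
  interpret J: finite_product_sigma_finite "\<lambda>_::'n. lborel :: real measure" "- I" by standard simp
  interpret pair_sigma_finite "Pi\<^sub>M I (\<lambda>_. lborel :: real measure)" "Pi\<^sub>M (- I) (\<lambda>_. lborel :: real measure)"
    by standard
  have "AE z in (lborel :: (real ^ 'n) measure). z \<notin> N"
    using assms by (simp add: negligible_iff_null_sets null_sets_completion_iff2 eventually_ae_filter)
  then have "AE w in Pi\<^sub>M UNIV (\<lambda>_. lborel). vec_lambda w \<notin> N"
    unfolding lborel_vec_eq_distr_PiM
    by (rule AE_distrD[rotated]) (rule borel_measurable_vec_lambda)
  moreover have "Pi\<^sub>M UNIV (\<lambda>_. lborel :: real measure) =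
      distr (Pi\<^sub>M I (\<lambda>_. lborel) \<Otimes>\<^sub>M Pi\<^sub>M (- I) (\<lambda>_. lborel)) (Pi\<^sub>M (I \<union> - I) (\<lambda>_. lborel)) (merge I (- I))"
    by (subst distr_merge) (auto simp: Compl_partition)
  ultimately have "AE w in distr (Pi\<^sub>M I (\<lambda>_. lborel :: real measure) \<Otimes>\<^sub>M Pi\<^sub>M (- I) (\<lambda>_. lborel))
      (Pi\<^sub>M (I \<union> - I) (\<lambda>_. lborel)) (merge I (- I)). vec_lambda w \<notin> N"
    by metis
  then have "AE w in Pi\<^sub>M I (\<lambda>_. lborel :: real measure) \<Otimes>\<^sub>M Pi\<^sub>M (- I) (\<lambda>_. lborel).
      vec_lambda (merge I (- I) w) \<notin> N"
    by (rule AE_distrD[OF measurable_merge])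
  then have "AE x in Pi\<^sub>M I (\<lambda>_. lborel :: real measure). AE y in Pi\<^sub>M (- I) (\<lambda>_. lborel).
      vec_lambda (merge I (- I) (x, y)) \<notin> N"
    by (rule AE_pair)
  then show ?thesis
  proof eventually_elim
    case (elim x)
    \<comment> \<open>Extracting one filler from an almost everywhere statement requires that the
      measure on the fillers is not zero.\<close>
    have "emeasure (Pi\<^sub>M (- I) (\<lambda>_. lborel :: real measure)) (\<Pi>\<^sub>E i\<in>- I. UNIV) \<noteq> 0"
      by (subst emeasure_PiM) auto
    then have "\<not> (AE y in Pi\<^sub>M (- I) (\<lambda>_. lborel :: real measure). False)"
      by (auto elim!: AE_E dest!: sets.sets_into_space simp: space_PiM)
    with elim obtain y where "vec_lambda (merge I (- I) (x, y)) \<notin> N"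
      by (metis (mono_tags, lifting) eventually_mono)
    moreover have "vec_lambda (merge I (- I) (x, y)) = (\<chi> k. if k \<in> I then x k else y k)"
      by (simp add: vec_eq_iff merge_def)
    ultimately show ?case
      by metis
  qed
qed


subsection \<open>Payoffs of pure strategies\<close>

text \<open>The product omits player \<open>i\<close>, so the value does not depend on
  \<open>\<sigma> i\<close>.\<close>

definition pure_payoff ::
    "('p::finite \<Rightarrow> 'a::finite set) \<Rightarrow> ('p \<times> ('p \<Rightarrow> 'a) \<Rightarrow> real) \<Rightarrow> 'p \<Rightarrow> 'a \<Rightarrow> ('p \<Rightarrow> 'a \<Rightarrow> real) \<Rightarrow> real"
  where
  "pure_payoff S G i a \<sigma> =
     (\<Sum>s | s \<in> pure_profiles S \<and> s i = a. (\<Prod>j\<in>UNIV - {i}. \<sigma> j (s j)) * G (i, s))"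

lemma pure_profilesD: "s \<in> pure_profiles S \<Longrightarrow> s i \<in> S i"
  by (auto simp: pure_profiles_def)

text \<open>Grouping the profiles by the strategy of \<open>i\<close> exhibits expected utility as
  linear in \<open>\<sigma> i\<close>.\<close>

lemma expected_utility_eq_pure_payoff:
  "expected_utility S G i \<sigma> = (\<Sum>a\<in>S i. \<sigma> i a * pure_payoff S G i a \<sigma>)"
proof -
  have "(\<Prod>j\<in>UNIV. \<sigma> j (s j)) = \<sigma> i (s i) * (\<Prod>j\<in>UNIV - {i}. \<sigma> j (s j))" for s
    by (rule prod.remove) auto
  then have "expected_utility S G i \<sigma> =
    (\<Sum>s\<in>pure_profiles S. \<sigma> i (s i) * ((\<Prod>j\<in>UNIV - {i}. \<sigma> j (s j)) * G (i, s)))"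
    by (simp add: expected_utility_def mult.assoc)
  also have "\<dots> = (\<Sum>a\<in>S i. \<Sum>s | s \<in> pure_profiles S \<and> s i = a.
      \<sigma> i (s i) * ((\<Prod>j\<in>UNIV - {i}. \<sigma> j (s j)) * G (i, s)))"
    by (rule sum.group[symmetric]) (auto simp: pure_profilesD)
  also have "\<dots> = (\<Sum>a\<in>S i. \<sigma> i a * pure_payoff S G i a \<sigma>)"
    by (simp add: pure_payoff_def sum_distrib_left)
  finally show ?thesis .
qed

lemma pure_payoff_cong:
  assumes "\<And>s. s \<in> pure_profiles S \<Longrightarrow> G (i, s) = G' (i, s)"
    and "\<And>j x. j \<noteq> i \<Longrightarrow> x \<in> S j \<Longrightarrow> \<sigma> j x = \<sigma>' j x"
  shows "pure_payoff S G i a \<sigma> = pure_payoff S G' i a \<sigma>'"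
  unfolding pure_payoff_def
  by (intro sum.cong arg_cong2[where f = "(*)"] prod.cong refl) (auto simp: assms pure_profilesD)

lemma pure_payoff_update: "pure_payoff S G i a (\<sigma>(i := \<tau>)) = pure_payoff S G i a \<sigma>"
  by (rule pure_payoff_cong) auto

text \<open>Giving player \<open>i\<close> the point mass at \<open>a\<close> turns the sum into the
  expansion of a product of sums equal to 1. Signs do not matter, so \<open>strategy T H\<close> is
  covered even where it has negative entries.\<close>

lemma opponent_weights_sum:
  assumes "a \<in> S i" and one: "\<And>j. j \<noteq> i \<Longrightarrow> (\<Sum>x\<in>S j. \<sigma> j x) = 1"
  shows "(\<Sum>s | s \<in> pure_profiles S \<and> s i = a. \<Prod>j\<in>UNIV - {i}. \<sigma> j (s j)) = (1::real)"
proof -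
  define \<rho> where "\<rho> = \<sigma>(i := (\<lambda>x. if x = a then 1 else 0))"
  have "(\<Sum>x\<in>S j. \<rho> j x) = 1" for j
    using assms by (cases "j = i") (auto simp: \<rho>_def)
  then have "1 = (\<Prod>j\<in>UNIV. \<Sum>x\<in>S j. \<rho> j x)"
    by simp
  also have "\<dots> = (\<Sum>s\<in>pure_profiles S. \<Prod>j\<in>UNIV. \<rho> j (s j))"
    unfolding pure_profiles_def by (rule prod_sum_PiE) auto
  also have "\<dots> = (\<Sum>s\<in>pure_profiles S. if s i = a then \<Prod>j\<in>UNIV - {i}. \<sigma> j (s j) else 0)"
  proof (rule sum.cong[OF refl])
    fix s
    have "(\<Prod>j\<in>UNIV. \<rho> j (s j)) = \<rho> i (s i) * (\<Prod>j\<in>UNIV - {i}. \<rho> j (s j))"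
      by (rule prod.remove) auto
    also have "(\<Prod>j\<in>UNIV - {i}. \<rho> j (s j)) = (\<Prod>j\<in>UNIV - {i}. \<sigma> j (s j))"
      by (rule prod.cong) (auto simp: \<rho>_def)
    finally show "(\<Prod>j\<in>UNIV. \<rho> j (s j)) = (if s i = a then \<Prod>j\<in>UNIV - {i}. \<sigma> j (s j) else 0)"
      by (simp add: \<rho>_def)
  qed
  also have "\<dots> = (\<Sum>s | s \<in> pure_profiles S \<and> s i = a. \<Prod>j\<in>UNIV - {i}. \<sigma> j (s j))"
    by (rule sum.inter_filter[symmetric]) simp
  finally show ?thesis by simp
qed

text \<open>A bonus depending on the player's own strategy alone passes through the expectation,
  because the opponents' weights sum to 1. This is why the shifts in \<open>encode\<close> and
  \<open>game_of\<close> can be computed exactly.\<close>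

lemma pure_payoff_add:
  assumes "a \<in> S i" and "\<And>j. j \<noteq> i \<Longrightarrow> (\<Sum>x\<in>S j. \<sigma> j x) = 1"
    and G: "\<And>s. s \<in> pure_profiles S \<Longrightarrow> G (i, s) = G' (i, s) + c (s i)"
  shows "pure_payoff S G i a \<sigma> = pure_payoff S G' i a \<sigma> + c a"
proof -
  have "pure_payoff S G i a \<sigma> = pure_payoff S G' i a \<sigma> +
      (\<Sum>s | s \<in> pure_profiles S \<and> s i = a. \<Prod>j\<in>UNIV - {i}. \<sigma> j (s j)) * c a"
    unfolding pure_payoff_def
    by (simp add: G distrib_left sum.distrib sum_distrib_right)
  with opponent_weights_sum[of a S i \<sigma>] assms show ?thesis
    by simp
qed

lemma mixed_profilesD:
  assumes "\<sigma> \<in> mixed_profiles S"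
  shows "\<sigma> i \<in> extensional (S i)" "a \<in> S i \<Longrightarrow> 0 \<le> \<sigma> i a" "(\<Sum>a\<in>S i. \<sigma> i a) = 1"
  using assms by (auto simp: mixed_profiles_def mixed_strategies_def PiE_iff)

lemma mixed_profile_le_1:
  assumes "\<sigma> \<in> mixed_profiles S" "a \<in> S i"
  shows "\<sigma> i a \<le> 1"
  using member_le_sum[of a "S i" "\<sigma> i"] mixed_profilesD[OF assms(1)] assms(2) by auto

text \<open>Expected utility is an average of pure payoffs, so an equilibrium puts weight only on
  the maximal ones; \<open>v\<close> is the equilibrium payoff of player \<open>i\<close>.\<close>

lemma nash_equilibria_iff:
  "\<sigma> \<in> nash_equilibria S G \<longleftrightarrow> \<sigma> \<in> mixed_profiles S \<and>
    (\<forall>i. \<exists>v. \<forall>a\<in>S i. pure_payoff S G i a \<sigma> \<le> v \<and> (\<sigma> i a \<noteq> 0 \<longrightarrow> pure_payoff S G i a \<sigma> = v))"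
    (is "?L \<longleftrightarrow> ?R")
proof
  assume ?L
  then have \<sigma>: "\<sigma> \<in> mixed_profiles S"
    by (simp add: nash_equilibria_def)
  have "\<forall>a\<in>S i. pure_payoff S G i a \<sigma> \<le> expected_utility S G i \<sigma> \<and>
     (\<sigma> i a \<noteq> 0 \<longrightarrow> pure_payoff S G i a \<sigma> = expected_utility S G i \<sigma>)" for i
  proof -
    let ?v = "expected_utility S G i \<sigma>"
    have le: "pure_payoff S G i a \<sigma> \<le> ?v" if "a \<in> S i" for a
    proof -
      \<comment> \<open>This is the deviation to the pure strategy \<open>a\<close>.\<close>
      define \<tau> where "\<tau> = restrict (\<lambda>x. if x = a then 1 else 0 :: real) (S i)"
      have "\<tau> \<in> mixed_strategies (S i)"
        using that by (auto simp: \<tau>_def mixed_strategies_def)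
      with \<open>?L\<close> have "expected_utility S G i (\<sigma>(i := \<tau>)) \<le> ?v"
        by (auto simp: nash_equilibria_def)
      moreover have "(\<Sum>x\<in>S i. \<tau> x * pure_payoff S G i x \<sigma>) =
          (\<Sum>x\<in>S i. if x = a then pure_payoff S G i x \<sigma> else 0)"
        by (rule sum.cong) (auto simp: \<tau>_def)
      ultimately show ?thesis
        using that by (simp add: expected_utility_eq_pure_payoff[of S G i "\<sigma>(i := \<tau>)"] pure_payoff_update)
    qed
    \<comment> \<open>The weighted payoff gaps are nonnegative and sum to zero, so each of them
      vanishes.\<close>
    have "(\<Sum>a\<in>S i. \<sigma> i a * (?v - pure_payoff S G i a \<sigma>)) = 0"
      using mixed_profilesD(3)[OF \<sigma>, of i] expected_utility_eq_pure_payoff[of S G i \<sigma>]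
      by (simp add: right_diff_distrib sum_subtractf flip: sum_distrib_right)
    then have "\<forall>a\<in>S i. \<sigma> i a * (?v - pure_payoff S G i a \<sigma>) = 0"
      using le mixed_profilesD(2)[OF \<sigma>] by (subst (asm) sum_nonneg_eq_0_iff) auto
    with le show ?thesis by auto
  qed
  with \<sigma> show ?R by blast
next
  assume R: ?R
  have "expected_utility S G i (\<sigma>(i := \<tau>)) \<le> expected_utility S G i \<sigma>"
    if \<tau>: "\<tau> \<in> mixed_strategies (S i)" for i \<tau>
  proof -
    obtain v where v: "\<And>a. a \<in> S i \<Longrightarrow> pure_payoff S G i a \<sigma> \<le> v"
      "\<And>a. a \<in> S i \<Longrightarrow> \<sigma> i a \<noteq> 0 \<Longrightarrow> pure_payoff S G i a \<sigma> = v"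
      using R by metis
    have "expected_utility S G i (\<sigma>(i := \<tau>)) \<le> (\<Sum>a\<in>S i. \<tau> a * v)"
      using \<tau> v(1) by (auto simp: expected_utility_eq_pure_payoff pure_payoff_update mixed_strategies_def
          intro!: sum_mono mult_left_mono)
    also have "\<dots> = (\<Sum>a\<in>S i. \<sigma> i a * v)"
      using \<tau> R mixed_profilesD(3)[of \<sigma> S i] by (simp add: mixed_strategies_def flip: sum_distrib_right)
    also have "\<dots> = (\<Sum>a\<in>S i. \<sigma> i a * pure_payoff S G i a \<sigma>)"
      using v(2) by (intro sum.cong) auto
    finally show ?thesis by (simp add: expected_utility_eq_pure_payoff)
  qed
  with R show ?L by (simp add: nash_equilibria_def)
qed

lemma nash_equilibria_cong:
  assumes "\<And>i s. s \<in> pure_profiles S \<Longrightarrow> G (i, s) = G' (i, s)"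
  shows "nash_equilibria S G = nash_equilibria S G'"
  using assms by (simp add: nash_equilibria_def expected_utility_def)

subsection \<open>The parametrisation of the equilibrium graph\<close>

text \<open>The sum decreases strictly in the level as long as a term is positive, and a total of 1
  forces a positive term. Hence the values determine the level, whichever support is used to compute
  it.\<close>

lemma water_level_unique:
  fixes z :: "'i \<Rightarrow> real"
  assumes "finite A" and v: "(\<Sum>a\<in>A. max (z a - v) 0) = 1" and w: "(\<Sum>a\<in>A. max (z a - w) 0) = 1"
  shows "v = w"
proof -
  have "\<not> v < w"
    if v: "(\<Sum>a\<in>A. max (z a - v) 0) = 1" and w: "(\<Sum>a\<in>A. max (z a - w) 0) = 1" for v w
  proof
    assume "v < w"
    have "\<exists>a\<in>A. max (z a - w) 0 \<noteq> 0"
    proof (rule ccontr)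
      assume "\<not> ?thesis"
      then have "(\<Sum>a\<in>A. max (z a - w) 0) = 0"
        by (intro sum.neutral) blast
      with w show False by simp
    qed
    then obtain a where "a \<in> A" "w < z a"
      by (auto simp: max_def split: if_splits)
    then have "(\<Sum>a\<in>A. max (z a - w) 0) < (\<Sum>a\<in>A. max (z a - v) 0)"
      using \<open>v < w\<close> by (intro sum_strict_mono_ex1 assms(1) bexI[of _ a] ballI) auto
    with v w show False by simp
  qed
  from this[OF v w] this[OF w v] show ?thesis by simp
qed

locale game_form =
  fixes S :: "'p::finite \<Rightarrow> 'a::finite set" and b :: "'p \<Rightarrow> 'a"
  assumes base: "b \<in> pure_profiles S"
begin

text \<open>Profiles in which the opponents follow \<open>b\<close> serve as probes: adding a
  function of the own strategy changes these numbers by exactly that function.\<close>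

definition value_at :: "real ^ ('p \<times> ('p \<Rightarrow> 'a)) \<Rightarrow> 'p \<Rightarrow> 'a \<Rightarrow> real" where
  "value_at H i a = H $ (i, b(i := a))"

definition supports :: "('p \<Rightarrow> 'a set) set" where
  "supports = {T. \<forall>i. T i \<noteq> {} \<and> T i \<subseteq> S i}"

text \<open>The level is chosen so that the entries of \<open>strategy T H i\<close> below sum to \<open>1\<close>.\<close>

definition level :: "('p \<Rightarrow> 'a set) \<Rightarrow> real ^ ('p \<times> ('p \<Rightarrow> 'a)) \<Rightarrow> 'p \<Rightarrow> real" where
  "level T H i = ((\<Sum>a\<in>T i. value_at H i a) - 1) / card (T i)"

text \<open>Membership in \<open>T i\<close>, not the sign of the difference, decides the case, so
  for fixed \<open>T\<close> each entry is affine in \<open>H\<close> on the whole space. For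
  \<open>T\<close> in \<open>supports\<close> and \<open>H\<close> in \<open>region T\<close>, this
  is the Euclidean projection of the values onto the simplex over \<open>S i\<close>.\<close>

definition strategy :: "('p \<Rightarrow> 'a set) \<Rightarrow> real ^ ('p \<times> ('p \<Rightarrow> 'a)) \<Rightarrow> 'p \<Rightarrow> 'a \<Rightarrow> real" where
  "strategy T H i a = (if a \<in> T i then value_at H i a - level T H i else 0)"

text \<open>The first inequalities make the weights nonnegative; the second keep strategies outside
  \<open>T i\<close> from earning more than the level.\<close>

definition region :: "('p \<Rightarrow> 'a set) \<Rightarrow> (real ^ ('p \<times> ('p \<Rightarrow> 'a))) set" where
  "region T = {H. \<forall>i. (\<forall>a\<in>T i. level T H i \<le> value_at H i a) \<and>
     (\<forall>a\<in>S i - T i. value_at H i a \<le> level T H i)}"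

definition strict_region :: "('p \<Rightarrow> 'a set) \<Rightarrow> (real ^ ('p \<times> ('p \<Rightarrow> 'a))) set" where
  "strict_region T = {H. \<forall>i. (\<forall>a\<in>T i. level T H i < value_at H i a) \<and>
     (\<forall>a\<in>S i - T i. value_at H i a < level T H i)}"

text \<open>
  Payoffs are modified so that, against \<open>strategy T H\<close>, every \<open>a \<in> T i\<close> earns \<open>level T H i\<close> and every
  other strategy earns its value.  The coordinates outside \<open>pure_profiles S\<close>, which are irrelevant to
  the game, are left alone.
\<close>

definition game_of ::
    "('p \<Rightarrow> 'a set) \<Rightarrow> real ^ ('p \<times> ('p \<Rightarrow> 'a)) \<Rightarrow> real ^ ('p \<times> ('p \<Rightarrow> 'a))" where
  "game_of T H = (\<chi> k. H $ k + (if snd k \<in> pure_profiles S then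
       (if snd k (fst k) \<in> T (fst k) then level T H (fst k) else value_at H (fst k) (snd k (fst k)))
       - pure_payoff S (($) H) (fst k) (snd k (fst k)) (strategy T H) else 0))"

definition encode ::
    "real ^ ('p \<times> ('p \<Rightarrow> 'a)) \<Rightarrow> ('p \<Rightarrow> 'a \<Rightarrow> real) \<Rightarrow> real ^ ('p \<times> ('p \<Rightarrow> 'a))" where
  "encode G \<sigma> = (\<chi> k. G $ k + (if snd k \<in> pure_profiles S then
       \<sigma> (fst k) (snd k (fst k)) + pure_payoff S (($) G) (fst k) (snd k (fst k)) \<sigma>
       - value_at G (fst k) (snd k (fst k)) else 0))"

text \<open>This is the fibre over \<open>G\<close> of the piecewise polynomial map given by
  \<open>game_of T\<close> on \<open>region T\<close>.\<close>

definition codes :: "real ^ ('p \<times> ('p \<Rightarrow> 'a)) \<Rightarrow> (real ^ ('p \<times> ('p \<Rightarrow> 'a))) set" where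
  "codes G = {H. \<exists>T\<in>supports. H \<in> region T \<and> game_of T H = G}"

section \<open>Correspondence between equilibria and codes\<close>

lemma base_update: "a \<in> S i \<Longrightarrow> b(i := a) \<in> pure_profiles S"
  using base by (auto simp: pure_profiles_def)

lemma supportsD: "T \<in> supports \<Longrightarrow> T i \<noteq> {}" "T \<in> supports \<Longrightarrow> T i \<subseteq> S i"
  by (auto simp: supports_def)

lemma sum_strategy:
  assumes "T \<in> supports"
  shows "(\<Sum>a\<in>S i. strategy T H i a) = 1"
proof -
  have "(\<Sum>a\<in>S i. strategy T H i a) = (\<Sum>a\<in>T i. value_at H i a - level T H i)"
    unfolding strategy_def using supportsD[OF assms, of i]
    by (simp add: sum.If_cases Int_absorb1)
  also have "\<dots> = 1"
    using supportsD[OF assms, of i] by (simp add: sum_subtractf level_def)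
  finally show ?thesis .
qed

text \<open>On its region the support enters only through the level, which makes
  \<open>water_level_unique\<close> applicable.\<close>

lemma strategy_eq_max:
  assumes "H \<in> region T" "a \<in> S i"
  shows "strategy T H i a = max (value_at H i a - level T H i) 0"
  using assms by (auto simp: region_def strategy_def max_def intro: antisym)

lemma strict_region_subset: "strict_region T \<subseteq> region T"
  by (auto simp: region_def strict_region_def less_imp_le)

text \<open>Both levels solve the same equation in the values of \<open>H\<close>, so they agree,
  and the strict inequalities then decide membership. Consequently a single polynomial map describes
  the fibres inside a strict region.\<close>

lemma supports_eq_of_strict_region:
  assumes T: "T \<in> supports" "H \<in> strict_region T" and T': "T' \<in> supports" "H \<in> region T'"
  shows "T' = T"
proof
  fix i
  have H: "H \<in> region T"
    using T strict_region_subset by auto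
  have "(\<Sum>a\<in>S i. max (value_at H i a - level T H i) 0) = 1"
    using sum_strategy[OF T(1), of H i] H by (simp add: strategy_eq_max)
  moreover have "(\<Sum>a\<in>S i. max (value_at H i a - level T' H i) 0) = 1"
    using sum_strategy[OF T'(1), of H i] T'(2) by (simp add: strategy_eq_max)
  ultimately have eq: "level T H i = level T' H i"
    by (rule water_level_unique[OF finite])
  show "T' i = T i"
  proof (rule set_eqI)
    fix a
    have "a \<in> T' i \<longleftrightarrow> a \<in> T i" if "a \<in> S i"
    proof -
      have "a \<in> T i \<longrightarrow> level T H i < value_at H i a" "a \<notin> T i \<longrightarrow> value_at H i a < level T H i"
        using T(2) that by (auto simp: strict_region_def)
      moreover have "a \<in> T' i \<longrightarrow> level T' H i \<le> value_at H i a" "a \<notin> T' i \<longrightarrow> value_at H i a \<le> level T' H i"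
        using T'(2) that by (auto simp: region_def)
      ultimately show ?thesis
        using eq by linarith
    qed
    then show "a \<in> T' i \<longleftrightarrow> a \<in> T i"
      using supportsD(2)[OF T(1), of i] supportsD(2)[OF T'(1), of i] by blast
  qed
qed

text \<open>The shift in \<open>game_of\<close> cancels the original payoff. \<open>H\<close> need
  not lie in \<open>region T\<close>, since only the total of the weights matters.\<close>

lemma pure_payoff_game_of:
  assumes T: "T \<in> supports" and a: "a \<in> S i"
  shows "pure_payoff S (($) (game_of T H)) i a (strategy T H) =
    (if a \<in> T i then level T H i else value_at H i a)"
proof -
  have "pure_payoff S (($) (game_of T H)) i a (strategy T H) = pure_payoff S (($) H) i a (strategy T H) +
    ((if a \<in> T i then level T H i else value_at H i a) - pure_payoff S (($) H) i a (strategy T H))"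
    by (rule pure_payoff_add[where c = "\<lambda>x. (if x \<in> T i then level T H i else value_at H i x)
        - pure_payoff S (($) H) i x (strategy T H)"]) (auto simp: a sum_strategy[OF T] game_of_def)
  then show ?thesis by simp
qed

text \<open>The factor 2 arises because the payoff enters once through \<open>G\<close> and once
  through the shift.\<close>

lemma pure_payoff_encode:
  assumes "\<sigma> \<in> mixed_profiles S" and a: "a \<in> S i"
  shows "pure_payoff S (($) (encode G \<sigma>)) i a \<sigma> =
    2 * pure_payoff S (($) G) i a \<sigma> + \<sigma> i a - value_at G i a"
proof -
  have "pure_payoff S (($) (encode G \<sigma>)) i a \<sigma> = pure_payoff S (($) G) i a \<sigma> +
    (\<sigma> i a + pure_payoff S (($) G) i a \<sigma> - value_at G i a)"
    by (rule pure_payoff_add[where c = "\<lambda>x. \<sigma> i x + pure_payoff S (($) G) i x \<sigma> - value_at G i x"])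
      (auto simp: a mixed_profilesD[OF assms(1)] encode_def)
  then show ?thesis by simp
qed

lemma value_at_encode:
  assumes "a \<in> S i"
  shows "value_at (encode G \<sigma>) i a = \<sigma> i a + pure_payoff S (($) G) i a \<sigma>"
  using base_update[OF assms] by (simp add: value_at_def encode_def)

text \<open>\<open>level T H i\<close> is the equilibrium payoff of player \<open>i\<close>. The
  code is recovered because weight plus payoff equals the value:
  \<open>(value - level) + level\<close> on the support and \<open>0 + value\<close> off it.\<close>

lemma codes_imp_nash:
  assumes T: "T \<in> supports" and H: "H \<in> region T"
  defines "\<sigma> \<equiv> \<lambda>i. restrict (strategy T H i) (S i)"
  shows "\<sigma> \<in> nash_equilibria S (($) (game_of T H))" "encode (game_of T H) \<sigma> = H"
proof -
  have pay: "pure_payoff S (($) (game_of T H)) i a \<sigma> =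
      (if a \<in> T i then level T H i else value_at H i a)" if "a \<in> S i" for i a
    using pure_payoff_game_of[OF T that, of H]
      pure_payoff_cong[of S "($) (game_of T H)" i "($) (game_of T H)" \<sigma> "strategy T H" a]
    by (simp add: \<sigma>_def)
  have "\<sigma> i \<in> mixed_strategies (S i)" for i
    using sum_strategy[OF T, of H i] strategy_eq_max[OF H]
    by (auto simp: \<sigma>_def mixed_strategies_def)
  then have "\<sigma> \<in> mixed_profiles S"
    by (simp add: mixed_profiles_def PiE_iff)
  moreover have "\<forall>a\<in>S i. pure_payoff S (($) (game_of T H)) i a \<sigma> \<le> level T H i \<and>
     (\<sigma> i a \<noteq> 0 \<longrightarrow> pure_payoff S (($) (game_of T H)) i a \<sigma> = level T H i)" for i
  proof
    fix a assume a: "a \<in> S i"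
    then have "\<sigma> i a = strategy T H i a"
      by (simp add: \<sigma>_def)
    then show "pure_payoff S (($) (game_of T H)) i a \<sigma> \<le> level T H i \<and>
        (\<sigma> i a \<noteq> 0 \<longrightarrow> pure_payoff S (($) (game_of T H)) i a \<sigma> = level T H i)"
      using a H by (auto simp: pay[OF a] region_def strategy_def)
  qed
  ultimately show "\<sigma> \<in> nash_equilibria S (($) (game_of T H))"
    unfolding nash_equilibria_iff by blast
  have eq: "\<sigma> i a + pure_payoff S (($) (game_of T H)) i a \<sigma> = value_at H i a" if "a \<in> S i" for i a
    using that pay[OF that] by (simp add: \<sigma>_def strategy_def)
  \<comment> \<open>By \<open>eq\<close> and \<open>val\<close>, the shift added by
    \<open>encode\<close> is the negative of the one added by \<open>game_of\<close>.\<close>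
  have val: "value_at (game_of T H) i a = value_at H i a +
      ((if a \<in> T i then level T H i else value_at H i a) - pure_payoff S (($) H) i a (strategy T H))"
    if "a \<in> S i" for i a
    using base_update[OF that] by (simp add: value_at_def game_of_def)
  show "encode (game_of T H) \<sigma> = H"
  proof (rule vec_eq_iff[THEN iffD2], rule allI)
    fix k :: "'p \<times> ('p \<Rightarrow> 'a)"
    obtain i s where k: "k = (i, s)" by fastforce
    show "encode (game_of T H) \<sigma> $ k = H $ k"
    proof (cases "s \<in> pure_profiles S")
      case True
      then have "s i \<in> S i" by (rule pure_profilesD)
      then show ?thesis
        using True eq[of "s i" i] val[of "s i" i] by (simp add: k encode_def) (simp add: game_of_def)
    qed (simp add: k encode_def game_of_def)
  qed
qed

text \<open>With the support of \<open>\<sigma>\<close> as \<open>T\<close>, the level is the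
  equilibrium payoff and the strategy is \<open>\<sigma>\<close>, so the shifts of
  \<open>encode\<close> and \<open>game_of\<close> cancel.\<close>

lemma nash_imp_codes:
  assumes \<sigma>: "\<sigma> \<in> nash_equilibria S (($) G)"
  shows "encode G \<sigma> \<in> codes G"
proof -
  have mixed: "\<sigma> \<in> mixed_profiles S"
    using \<sigma> by (simp add: nash_equilibria_iff)
  obtain v where v: "\<And>i a. a \<in> S i \<Longrightarrow> pure_payoff S (($) G) i a \<sigma> \<le> v i"
    "\<And>i a. a \<in> S i \<Longrightarrow> \<sigma> i a \<noteq> 0 \<Longrightarrow> pure_payoff S (($) G) i a \<sigma> = v i"
    using \<sigma> unfolding nash_equilibria_iff by metis
  define H where "H = encode G \<sigma>"
  define T where "T = (\<lambda>i. {a \<in> S i. \<sigma> i a \<noteq> 0})"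
  have T: "T \<in> supports"
  proof -
    have "T i \<noteq> {}" for i
    proof
      assume "T i = {}"
      then have "(\<Sum>a\<in>S i. \<sigma> i a) = 0"
        by (intro sum.neutral) (auto simp: T_def)
      with mixed_profilesD(3)[OF mixed, of i] show False by simp
    qed
    then show ?thesis by (auto simp: supports_def T_def)
  qed
  have val: "value_at H i a = \<sigma> i a + pure_payoff S (($) G) i a \<sigma>" if "a \<in> S i" for i a
    using value_at_encode[OF that] by (simp add: H_def)
  \<comment> \<open>On the support each value is the weight plus \<open>v i\<close>, and the weights
    there sum to 1.\<close>
  have level: "level T H i = v i" for i
  proof -
    have "(\<Sum>a\<in>T i. value_at H i a) = (\<Sum>a\<in>T i. \<sigma> i a) + card (T i) * v i"
      by (simp add: T_def val v(2) sum.distrib)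
    also have "(\<Sum>a\<in>T i. \<sigma> i a) = (\<Sum>a\<in>S i. \<sigma> i a)"
      by (rule sum.mono_neutral_left) (auto simp: T_def)
    finally show ?thesis
      using mixed_profilesD(3)[OF mixed, of i] supportsD(1)[OF T, of i] by (simp add: level_def)
  qed
  have strat: "strategy T H i a = \<sigma> i a" if "a \<in> S i" for i a
  proof (cases "a \<in> T i")
    case True
    then show ?thesis
      using val[OF that] v(2)[OF that] by (simp add: strategy_def level) (simp add: T_def)
  next
    case False
    then show ?thesis
      using that by (simp add: strategy_def) (simp add: T_def)
  qed
  have "H \<in> region T"
    unfolding region_def
  proof (intro CollectI allI conjI ballI)
    fix i a
    show "level T H i \<le> value_at H i a" if "a \<in> T i"
    proof -
      have "a \<in> S i" "\<sigma> i a \<noteq> 0"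
        using that by (auto simp: T_def)
      then show ?thesis
        using v(2) mixed_profilesD(2)[OF mixed] by (simp add: level val)
    qed
    show "value_at H i a \<le> level T H i" if "a \<in> S i - T i"
    proof -
      have "a \<in> S i" "\<sigma> i a = 0"
        using that by (auto simp: T_def)
      then show ?thesis
        using v(1) by (simp add: level val)
    qed
  qed
  moreover have "game_of T H = G"
  proof (rule vec_eq_iff[THEN iffD2], rule allI)
    fix k :: "'p \<times> ('p \<Rightarrow> 'a)"
    obtain i s where k: "k = (i, s)" by fastforce
    show "game_of T H $ k = G $ k"
    proof (cases "s \<in> pure_profiles S")
      case True
      then have si: "s i \<in> S i" by (rule pure_profilesD)
      have "(if s i \<in> T i then level T H i else value_at H i (s i)) = pure_payoff S (($) G) i (s i) \<sigma>"
        using si v(2)[OF si] by (simp add: level val) (simp add: T_def)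
      moreover have "pure_payoff S (($) H) i (s i) (strategy T H) = pure_payoff S (($) H) i (s i) \<sigma>"
        by (rule pure_payoff_cong) (auto simp: strat)
      moreover have "pure_payoff S (($) H) i (s i) \<sigma> =
          2 * pure_payoff S (($) G) i (s i) \<sigma> + \<sigma> i (s i) - value_at G i (s i)"
        using pure_payoff_encode[OF mixed si] by (simp add: H_def)
      moreover have "H $ k = G $ k + (\<sigma> i (s i) + pure_payoff S (($) G) i (s i) \<sigma> - value_at G i (s i))"
        using True by (simp add: H_def encode_def k)
      ultimately show ?thesis
        using True by (auto simp: game_of_def k split: if_splits)
    qed (simp add: k H_def encode_def game_of_def)
  qed
  ultimately show ?thesis
    using T by (auto simp: codes_def H_def)
qed

text \<open>Each strategy is the part of the values above some level, and the total weight 1 fixes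
  that level; so the code alone determines the equilibrium.\<close>

lemma inj_on_encode: "inj_on (encode G) (nash_equilibria S (($) G))"
proof (rule inj_onI)
  fix \<sigma> \<sigma>' assume \<sigma>: "\<sigma> \<in> nash_equilibria S (($) G)" and \<sigma>': "\<sigma>' \<in> nash_equilibria S (($) G)"
    and eq: "encode G \<sigma> = encode G \<sigma>'"
  have *: "\<exists>v. (\<forall>a\<in>S i. \<sigma> i a = max (value_at (encode G \<sigma>) i a - v) 0) \<and>
      (\<Sum>a\<in>S i. max (value_at (encode G \<sigma>) i a - v) 0) = 1"
    if \<sigma>: "\<sigma> \<in> nash_equilibria S (($) G)" for \<sigma> i
  proof -
    obtain v where v: "\<And>a. a \<in> S i \<Longrightarrow> pure_payoff S (($) G) i a \<sigma> \<le> v"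
      "\<And>a. a \<in> S i \<Longrightarrow> \<sigma> i a \<noteq> 0 \<Longrightarrow> pure_payoff S (($) G) i a \<sigma> = v"
      using \<sigma> unfolding nash_equilibria_iff by metis
    have mixed: "\<sigma> \<in> mixed_profiles S"
      using \<sigma> by (simp add: nash_equilibria_iff)
    have "\<sigma> i a = max (value_at (encode G \<sigma>) i a - v) 0" if "a \<in> S i" for a
      using v[OF that] mixed_profilesD(2)[OF mixed that] value_at_encode[OF that, of G \<sigma>]
      by (cases "\<sigma> i a = 0") auto
    moreover from this have "(\<Sum>a\<in>S i. max (value_at (encode G \<sigma>) i a - v) 0) = 1"
      using mixed_profilesD(3)[OF mixed, of i] by simp
    ultimately show ?thesis by blast
  qed
  show "\<sigma> = \<sigma>'"
  proof
    fix i
    obtain v where v: "\<And>a. a \<in> S i \<Longrightarrow> \<sigma> i a = max (value_at (encode G \<sigma>) i a - v) 0"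
      "(\<Sum>a\<in>S i. max (value_at (encode G \<sigma>) i a - v) 0) = 1"
      using *[OF \<sigma>, of i] by auto
    obtain v' where v': "\<And>a. a \<in> S i \<Longrightarrow> \<sigma>' i a = max (value_at (encode G \<sigma>) i a - v') 0"
      "(\<Sum>a\<in>S i. max (value_at (encode G \<sigma>) i a - v') 0) = 1"
      using *[OF \<sigma>', of i] unfolding eq by auto
    have "v = v'"
      by (rule water_level_unique[OF _ v(2) v'(2)]) simp
    \<comment> \<open>Outside \<open>S i\<close> the two strategies agree by extensionality.\<close>
    with v v' show "\<sigma> i = \<sigma>' i"
      using \<sigma> \<sigma>' by (intro extensionalityI[of _ "S i"]) (auto simp: nash_equilibria_iff mixed_profilesD)
  qed
qed

lemma bij_betw_encode: "bij_betw (encode G) (nash_equilibria S (($) G)) (codes G)"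
proof -
  have "H \<in> encode G ` nash_equilibria S (($) G)" if "H \<in> codes G" for H
    using that codes_imp_nash by (force simp: codes_def)
  then show ?thesis
    using inj_on_encode nash_imp_codes by (auto simp: bij_betw_def)
qed

section \<open>Smoothness and properness of the parametrisation\<close>

lemma continuously_differentiable_value_at: "continuously_differentiable (\<lambda>H. value_at H i a)"
  unfolding value_at_def by (rule continuously_differentiable_intros)

lemma continuously_differentiable_level: "continuously_differentiable (\<lambda>H. level T H i)"
  unfolding level_def divide_inverse
  by (intro continuously_differentiable_intros continuously_differentiable_value_at)

lemma continuously_differentiable_strategy: "continuously_differentiable (\<lambda>H. strategy T H i a)"
  unfolding strategy_def
  by (cases "a \<in> T i") (simp_all add: continuously_differentiable_intros
      continuously_differentiable_value_at continuously_differentiable_level)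

text \<open>The case distinctions depend on \<open>k\<close> and \<open>T\<close> but not on
  \<open>H\<close>, so every component is polynomial in \<open>H\<close>.\<close>

lemma continuously_differentiable_game_of: "continuously_differentiable (game_of T)"
proof -
  have "continuously_differentiable (\<lambda>H. H $ k + (if snd k \<in> pure_profiles S then
       (if snd k (fst k) \<in> T (fst k) then level T H (fst k) else value_at H (fst k) (snd k (fst k)))
       - pure_payoff S (($) H) (fst k) (snd k (fst k)) (strategy T H) else 0))" for k
    unfolding pure_payoff_def
    by (cases "snd k \<in> pure_profiles S"; cases "snd k (fst k) \<in> T (fst k)")
      (simp_all add: continuously_differentiable_intros continuously_differentiable_value_at
        continuously_differentiable_level continuously_differentiable_strategy)
  then show ?thesis
    unfolding game_of_def by (rule continuously_differentiable_vec_lambda)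
qed

lemmas continuous_parametrisation =
  continuously_differentiable_imp_continuous_on[OF continuously_differentiable_value_at]
  continuously_differentiable_imp_continuous_on[OF continuously_differentiable_level]
  continuously_differentiable_imp_continuous_on[OF continuously_differentiable_game_of]

lemma closed_region: "closed (region T)"
proof -
  have "region T = (\<Inter>i. (\<Inter>a\<in>T i. {H. level T H i \<le> value_at H i a}) \<inter>
      (\<Inter>a\<in>S i - T i. {H. value_at H i a \<le> level T H i}))"
    by (auto simp: region_def)
  then show ?thesis
    by (auto intro!: closed_INT closed_Int closed_Collect_le continuous_parametrisation)
qed

lemma open_strict_region: "open (strict_region T)"
proof -
  have "strict_region T = (\<Inter>i. (\<Inter>a\<in>T i. {H. level T H i < value_at H i a}) \<inter>
      (\<Inter>a\<in>S i - T i. {H. value_at H i a < level T H i}))"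
    by (auto simp: strict_region_def)
  then show ?thesis
    by (auto intro!: open_INT open_Int open_Collect_less continuous_parametrisation)
qed

text \<open>There are finitely many supports, and the graph of a continuous map over a closed region
  is closed.\<close>

lemma closed_codes: "closed {(H, G). H \<in> codes G}"
proof -
  have "{(H, G). H \<in> codes G} = (\<Union>T\<in>supports. (region T \<times> UNIV) \<inter> {x. game_of T (fst x) = snd x})"
    by (auto simp: codes_def)
  moreover have "closed {x. game_of T (fst x) = snd x}" for T
    by (intro closed_Collect_eq continuous_on_compose2[OF continuous_parametrisation(3)[of UNIV T]]
        continuous_intros) auto
  ultimately show ?thesis
    by (auto intro!: closed_UN closed_Int closed_Times closed_region)
qed

text \<open>Each code comes from an equilibrium, whose weights lie in [0, 1], so
  \<open>encode\<close> bounds it in terms of the game.\<close>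

lemma bounded_codes: "bounded (\<Union>G\<in>ball G0 1. codes G)"
proof -
  define M where "M = norm G0 + 1"
  define C where "C = real (card (pure_profiles S)) * M"
  have "norm H \<le> real CARD('p \<times> ('p \<Rightarrow> 'a)) * (2 * M + 1 + C)" if G_ball: "G \<in> ball G0 1" and H_code: "H \<in> codes G" for G H
  proof -
    obtain \<sigma> where \<sigma>: "\<sigma> \<in> nash_equilibria S (($) G)" and H: "H = encode G \<sigma>"
      using bij_betw_encode[of G] H_code by (auto simp: bij_betw_def)
    have mixed: "\<sigma> \<in> mixed_profiles S"
      using \<sigma> by (simp add: nash_equilibria_iff)
    have "norm G \<le> M"
      using G_ball norm_triangle_ineq2[of G G0] by (auto simp: M_def dist_norm norm_minus_commute)
    then have G: "\<bar>G $ k\<bar> \<le> M" for k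
      using component_le_norm_cart[of G k] by linarith
    have "0 \<le> M"
      by (simp add: M_def)
    then have "0 \<le> C"
      by (simp add: C_def)
    have pay: "\<bar>pure_payoff S (($) G) i a \<sigma>\<bar> \<le> C" for i a
    proof -
      have "\<bar>pure_payoff S (($) G) i a \<sigma>\<bar> \<le>
        (\<Sum>s | s \<in> pure_profiles S \<and> s i = a. \<bar>(\<Prod>j\<in>UNIV - {i}. \<sigma> j (s j)) * G $ (i, s)\<bar>)"
        unfolding pure_payoff_def by (rule sum_abs)
      also have "\<dots> \<le> (\<Sum>s | s \<in> pure_profiles S \<and> s i = a. M)"
      proof (rule sum_mono)
        fix s assume "s \<in> {s. s \<in> pure_profiles S \<and> s i = a}"
        then have s: "s j \<in> S j" for j
          by (auto dest: pure_profilesD)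
        have "0 \<le> (\<Prod>j\<in>UNIV - {i}. \<sigma> j (s j))"
          using s mixed_profilesD(2)[OF mixed] by (intro prod_nonneg) auto
        moreover have "(\<Prod>j\<in>UNIV - {i}. \<sigma> j (s j)) \<le> 1"
          using s mixed_profilesD(2)[OF mixed] mixed_profile_le_1[OF mixed] by (intro prod_le_1) auto
        ultimately show "\<bar>(\<Prod>j\<in>UNIV - {i}. \<sigma> j (s j)) * G $ (i, s)\<bar> \<le> M"
          using mult_mono[of "\<Prod>j\<in>UNIV - {i}. \<sigma> j (s j)" 1 "\<bar>G $ (i, s)\<bar>" M] G
          by (simp add: abs_mult)
      qed
      also have "\<dots> \<le> C"
        using \<open>0 \<le> M\<close> by (auto simp: C_def intro!: mult_right_mono card_mono)
      finally show ?thesis .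
    qed
    \<comment> \<open>The bound allows for two entries of \<open>G\<close>, one weight and one pure
      payoff.\<close>
    have "\<bar>H $ k\<bar> \<le> 2 * M + 1 + C" for k
    proof (cases "snd k \<in> pure_profiles S")
      case True
      then have "snd k (fst k) \<in> S (fst k)"
        by (rule pure_profilesD)
      then have "0 \<le> \<sigma> (fst k) (snd k (fst k))" "\<sigma> (fst k) (snd k (fst k)) \<le> 1"
        using mixed_profilesD(2)[OF mixed] mixed_profile_le_1[OF mixed] by auto
      with True show ?thesis
        using G[of k] G[of "(fst k, b(fst k := snd k (fst k)))"] pay[of "fst k" "snd k (fst k)"]
        by (simp add: H encode_def value_at_def)
    next
      case False
      with G[of k] \<open>0 \<le> C\<close> \<open>0 \<le> M\<close> show ?thesis
        by (simp add: H encode_def)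
    qed
    then show ?thesis
      by (intro order.trans[OF norm_le_l1_cart sum_bounded_above[THEN order.trans]]) auto
  qed
  then show ?thesis
    by (intro boundedI) auto
qed

section \<open>The exceptional null set\<close>

lemma negligible_level_hyperplane:
  assumes "T \<in> supports"
  shows "negligible {H. value_at H i a = level T H i}"
proof -
  define c where "c = axis (i, b(i := a)) 1 - inverse (card (T i)) *\<^sub>R (\<Sum>x\<in>T i. axis (i, b(i := x)) (1::real))"
  have "card (T i) \<noteq> 0"
    using supportsD(1)[OF assms, of i] by simp
  have "c \<bullet> H = value_at H i a - inverse (card (T i)) * (\<Sum>x\<in>T i. value_at H i x)" for H
    by (simp add: c_def value_at_def inner_diff_left inner_sum_left inner_axis')
  moreover have "level T H i = inverse (card (T i)) * (\<Sum>x\<in>T i. value_at H i x) - inverse (card (T i))" for H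
    by (simp add: level_def divide_inverse algebra_simps)
  ultimately have "value_at H i a = level T H i \<longleftrightarrow> c \<bullet> H = - inverse (card (T i))" for H
    by auto
  \<comment> \<open>If \<open>T i = {a}\<close>, then \<open>c\<close> is zero; the nonzero
    right-hand side makes the set empty in that case.\<close>
  moreover have "negligible {H. c \<bullet> H = - inverse (card (T i))}"
    using \<open>card (T i) \<noteq> 0\<close> by (intro negligible_hyperplane) simp
  ultimately show ?thesis by simp
qed

lemma generic_nash_count:
  obtains N where "negligible N"
    and "\<And>G. G \<notin> N \<Longrightarrow> finite (nash_equilibria S (($) G)) \<and>
      (\<exists>W. open W \<and> G \<in> W \<and> (\<forall>G'\<in>W. finite (nash_equilibria S (($) G')) \<and>
        card (nash_equilibria S (($) G')) = card (nash_equilibria S (($) G))))"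
proof -
  have "\<exists>C. negligible (game_of T ` C) \<and> (\<forall>x D. x \<notin> C \<longrightarrow> open D \<longrightarrow> x \<in> D \<longrightarrow>
     (\<exists>U V g. open U \<and> x \<in> U \<and> U \<subseteq> D \<and> open V \<and> game_of T x \<in> V \<and> homeomorphism U V (game_of T) g))"
    for T
    using local_homeomorphism_or_critical[OF continuously_differentiable_game_of[of T]] by metis
  then obtain C where C: "\<And>T. negligible (game_of T ` C T)"
    and homeo: "\<And>T x D. x \<notin> C T \<Longrightarrow> open D \<Longrightarrow> x \<in> D \<Longrightarrow>
     \<exists>U V g. open U \<and> x \<in> U \<and> U \<subseteq> D \<and> open V \<and> game_of T x \<in> V \<and> homeomorphism U V (game_of T) g"
    by metis
  \<comment> \<open>These hyperplanes contain the boundaries of the regions; a differentiable map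
    between equal dimensions sends them to null sets.\<close>
  define Z where "Z = (\<lambda>T. \<Union>i. \<Union>a\<in>S i. {H. value_at H i a = level T H i})"
  define N where "N = (\<Union>T\<in>supports. game_of T ` C T \<union> game_of T ` Z T)"
  have "negligible (game_of T ` Z T)" if "T \<in> supports" for T
    using that by (intro negligible_differentiable_image_negligible
        continuously_differentiable_imp_differentiable_on continuously_differentiable_game_of)
      (auto simp: Z_def intro!: negligible_Union negligible_level_hyperplane)
  then have "negligible N"
    unfolding N_def using C by (auto intro!: negligible_Union negligible_Un)
  moreover have "finite (codes G) \<and> (\<exists>W. open W \<and> G \<in> W \<and>
      (\<forall>G'\<in>W. finite (codes G') \<and> card (codes G') = card (codes G)))" if "G \<notin> N" for G
  proof (rule card_solutions_locally_constant[OF closed_codes _ _ bounded_codes])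
    show "open (ball G 1)" "G \<in> ball G 1" by auto
    fix H assume "H \<in> codes G"
    then obtain T where T: "T \<in> supports" and H: "H \<in> region T" and G: "game_of T H = G"
      by (auto simp: codes_def)
    have "H \<notin> C T" "H \<notin> Z T"
      using that T G by (auto simp: N_def)
    \<comment> \<open>Off the hyperplanes the weak inequalities of \<open>region T\<close> become
      strict.\<close>
    have "H \<in> strict_region T"
      using H \<open>H \<notin> Z T\<close> supportsD(2)[OF T] unfolding region_def strict_region_def Z_def
      by (fastforce simp: less_le)
    with homeo[OF \<open>H \<notin> C T\<close> open_strict_region] obtain U V g where
      U: "open U" "H \<in> U" "U \<subseteq> strict_region T" and V: "open V" "game_of T H \<in> V"
      and h: "homeomorphism U V (game_of T) g"
      by metis
    \<comment> \<open>\<open>U\<close> lies inside the strict region, so no support other than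
      \<open>T\<close> contributes codes there.\<close>
    have "H' \<in> codes G' \<longleftrightarrow> game_of T H' = G'" if "H' \<in> U" for H' G'
      using that U(3) strict_region_subset T supports_eq_of_strict_region[OF T, of H']
      unfolding codes_def by blast
    with U V h G show "\<exists>U V f g. open U \<and> H \<in> U \<and> open V \<and> G \<in> V \<and>
      homeomorphism U V f g \<and> (\<forall>H'\<in>U. \<forall>G'. H' \<in> codes G' \<longleftrightarrow> f H' = G')"
      by metis
  qed
  ultimately show thesis
    using that[of N] by (simp add: bij_betw_finite[OF bij_betw_encode] bij_betw_same_card[OF bij_betw_encode])
qed

end

theorem mainTheorem8:
  fixes m :: "'p::finite \<Rightarrow> nat"
    and S :: "'p \<Rightarrow> 'a::finite set"
  assumes "\<And>i. m i \<ge> 1"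
    and "\<And>i. card (S i) = m i"
  shows "AE G in game_lebesgue S.
      finite (nash_equilibria S G) \<and>
      (\<exists>W. openin (game_topology S) W \<and> G \<in> W \<and>
        (\<forall>G'\<in>W. finite (nash_equilibria S G') \<and>
                 card (nash_equilibria S G') = card (nash_equilibria S G)))"
proof -
  have "S i \<noteq> {}" for i
    using assms(1)[of i] assms(2)[of i] by force
  then have "\<forall>i. \<exists>a. a \<in> S i"
    by blast
  then obtain b where "\<And>i. b i \<in> S i"
    by metis
  then interpret game_form S b
    by unfold_locales (simp add: pure_profiles_def PiE_iff)
  let ?I = "UNIV \<times> pure_profiles S"
  obtain N where N: "negligible N"
    and count: "\<And>G. G \<notin> N \<Longrightarrow> finite (nash_equilibria S (($) G)) \<and>
      (\<exists>W. open W \<and> G \<in> W \<and> (\<forall>G'\<in>W. finite (nash_equilibria S (($) G')) \<and>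
        card (nash_equilibria S (($) G')) = card (nash_equilibria S (($) G))))"
    using generic_nash_count by metis
  have "AE G in Pi\<^sub>M ?I (\<lambda>_. lborel). \<exists>y. (\<chi> k. if k \<in> ?I then G k else y k) \<notin> N"
    by (rule AE_PiM_extend_notin_negligible[OF N])
  then have "AE G in Pi\<^sub>M ?I (\<lambda>_. lborel). finite (nash_equilibria S G) \<and>
      (\<exists>W. openin (game_topology S) W \<and> G \<in> W \<and>
        (\<forall>G'\<in>W. finite (nash_equilibria S G') \<and>
                 card (nash_equilibria S G') = card (nash_equilibria S G)))"
    using AE_space
  proof eventually_elim
    case (elim G)
    then obtain y where y: "(\<chi> k. if k \<in> ?I then G k else y k) \<notin> N"
      by blast
    \<comment> \<open>The filler \<open>y\<close> found for \<open>G\<close> is kept fixed for all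
      games, which makes \<open>ext\<close> continuous; it does not affect the equilibria.\<close>
    define ext where "ext = (\<lambda>G. \<chi> k. if k \<in> ?I then G k else y k)"
    have nash: "nash_equilibria S (($) (ext G')) = nash_equilibria S G'" for G'
      by (rule nash_equilibria_cong) (simp add: ext_def)
    have "G \<in> topspace (game_topology S)"
      using elim by (simp add: game_topology_def space_PiM)
    have cont: "continuous_map (game_topology S) euclidean ext"
      unfolding continuous_map_atin limitin_canonical_iff
    proof (intro ballI vec_tendstoI)
      fix G k assume G: "G \<in> topspace (game_topology S)"
      show "((\<lambda>G. ext G $ k) \<longlongrightarrow> ext G $ k) (atin (game_topology S) G)"
      proof (cases "k \<in> ?I")
        case True
        then have "continuous_map (game_topology S) euclideanreal (\<lambda>G. G k)"
          unfolding game_topology_def by (rule continuous_map_product_projection)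
        with G True show ?thesis
          by (simp add: continuous_map_atin ext_def)
      qed (simp add: ext_def)
    qed
    obtain W where W: "open W" "ext G \<in> W" "\<forall>G'\<in>W. finite (nash_equilibria S (($) G')) \<and>
        card (nash_equilibria S (($) G')) = card (nash_equilibria S (($) (ext G)))"
      and fin: "finite (nash_equilibria S (($) (ext G)))"
      using count[OF y[folded ext_def]] by (auto simp: ext_def)
    have "openin (game_topology S) {G' \<in> topspace (game_topology S). ext G' \<in> W}"
      using openin_continuous_map_preimage[OF cont, of W] W(1) by simp
    moreover have "finite (nash_equilibria S G') \<and>
        card (nash_equilibria S G') = card (nash_equilibria S G)" if "ext G' \<in> W" for G'
      using W(3)[rule_format, OF that] unfolding nash .
    moreover have "finite (nash_equilibria S G)"
      using fin unfolding nash .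
    ultimately show ?case
      using W(2) \<open>G \<in> topspace (game_topology S)\<close> by blast
  qed
  then show ?thesis
    unfolding game_lebesgue_def by (rule AE_completion)
qed

end
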